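(* Let $b$ be an integer other than $0$, $-1$, and $-2$. Then $\mathbb{Q}(\alpha) \neq \mathbb{Q}(\beta)$ holds for all $\alpha, \beta \in I_b^{2,r}$ with $\alpha \neq \beta$.
   Context: For an integer $n$ with $n \ge 1$ or $n \le -3$, the set $I_n^{2,r}$ of real numbers is defined by $$I_n^{2,r} := \{\alpha \in (0,1) \mid \alpha^2+n\alpha+c=0 \text{ for some } c \in \mathbb{Z},\ -n \le c \le -1\} \quad \text{if } n \ge 1,$$ $$I_n^{2,r} := \{\alpha \in (0,1) \mid \alpha^2+n\alpha+c=0 \text{ for some } c \in \mathbb{Z},\ 1 \le c \le -n-2\} \quad \text{if } n \le -3.$$ Here $(0,1)$ is the open unit interval, and $\mathbb{Q}(\alpha)$ denotes the subfield of $\mathbb{C}$ generated by $\alpha$. *)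

theory Defs
  imports Complex_Main "HOL-Algebra.Generated_Fields" "HOL-Algebra.Algebraic_Closure_Type"
begin

text \<open>
  The set \<open>I\<^sub>n\<^sup>2\<^sup>,\<^sup>r\<close>. It is only introduced for \<open>n \<ge> 1\<close> and \<open>n \<le> -3\<close>; the remaining
  case is left unspecified.
\<close>

definition I2r :: "int \<Rightarrow> real set" where
  "I2r n =
    (if n \<ge> 1 then
       {\<alpha>. 0 < \<alpha> \<and> \<alpha> < 1 \<and>
           (\<exists>c::int. - n \<le> c \<and> c \<le> - 1 \<and> \<alpha>\<^sup>2 + of_int n * \<alpha> + of_int c = 0)}
     else if n \<le> - 3 then
       {\<alpha>. 0 < \<alpha> \<and> \<alpha> < 1 \<and>
           (\<exists>c::int. 1 \<le> c \<and> c \<le> - n - 2 \<and> \<alpha>\<^sup>2 + of_int n * \<alpha> + of_int c = 0)}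
     else undefined)"

text \<open>
  \<open>\<rat>(z)\<close>: here \<open>ring_of_type_algebra\<close> is the field of complex numbers as a record.
  The rationals need not be added as generators, since every subfield of the complex
  numbers contains them.
\<close>

definition rat_adjoin :: "complex \<Rightarrow> complex set" where
  "rat_adjoin z = generate_field (ring_of_type_algebra :: complex ring) {z}"

lemma rat_adjoin_eq_Inter:
  "rat_adjoin z = \<Inter>{K. subfield K (ring_of_type_algebra :: complex ring) \<and> z \<in> K}"
proof -
  interpret field "ring_of_type_algebra :: complex ring"
    by (rule field_from_type_algebra)
  have sub: "{z} \<subseteq> carrier (ring_of_type_algebra :: complex ring)"
    by (simp add: ring_of_type_algebra_def)
  show ?thesis
    unfolding rat_adjoin_def
    using generate_field_is_subfield[OF sub] generate_field_min_subfield1[OF sub]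
      generate_field.incl[of z "{z}" "ring_of_type_algebra :: complex ring"]
    by blast
qed

end

theory Submission
  imports Defs
begin

text \<open>
  Both \<open>\<alpha>\<close> and \<open>\<beta>\<close> are algebraic integers of trace \<open>- b\<close>, irrational because they lie
  strictly between \<open>0\<close> and \<open>1\<close>. If they generated the same quadratic field, \<open>\<alpha> - \<beta>\<close> would
  be an algebraic integer of trace zero in it, so that \<open>(\<alpha> - \<beta>)\<^sup>2\<close> would be an integer;
  but \<open>0 < \<bar>\<alpha> - \<beta>\<bar> < 1\<close>. Integrality of the square is obtained from the
  discriminants \<open>D\<close>, \<open>E\<close>: their product is a square \<open>r\<^sup>2\<close>,
  \<open>4 (\<alpha> - \<beta>)\<^sup>2 = D + E - 2 r\<close>, and \<open>4\<close> divides the right-hand side.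
\<close>

text \<open>Inverses in the record are definite descriptions, which unfolding the record does not
  evaluate; uniqueness of inverses identifies them. The same holds for negatives below. Both serve
  the induction over \<open>generate_field\<close>.\<close>

lemma m_inv_ring_of_type_algebra:
  fixes x :: "'a :: field"
  assumes "x \<noteq> 0"
  shows "inv\<^bsub>ring_of_type_algebra\<^esub> x = inverse x"
proof -
  interpret field "ring_of_type_algebra :: 'a ring"
    by (rule field_from_type_algebra)
  show ?thesis
    by (rule comm_inv_char) (use assms in \<open>auto simp: ring_of_type_algebra_def\<close>)
qed

lemma a_inv_ring_of_type_algebra:
  fixes x :: "'a :: field"
  shows "\<ominus>\<^bsub>ring_of_type_algebra\<^esub> x = - x"
proof -
  interpret field "ring_of_type_algebra :: 'a ring"
    by (rule field_from_type_algebra)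
  show ?thesis
    by (rule minus_equality) (auto simp: ring_of_type_algebra_def)
qed

text \<open>The polynomial is monic, so the root is an algebraic integer, and rational algebraic
  integers are integers.\<close>

lemma Rats_int_root_imp_Ints:
  fixes x :: real
  assumes "x \<in> \<rat>" and "x\<^sup>2 + of_int n * x + of_int c = 0"
  shows "x \<in> \<int>"
proof (rule rational_algebraic_int_is_int[OF _ assms(1)])
  have "poly [:of_int c, of_int n, 1:] x = 0"
    using assms(2) by (simp add: power2_eq_square algebra_simps)
  then show "algebraic_int x"
    by (intro algebraic_int.intros[of "[:of_int c, of_int n, 1:]"])
       (auto simp: coeff_pCons split: nat.splits)
qed

text \<open>The other root of the equation is \<open>- n - \<alpha>\<close>, so
  \<open>p - n * q - q * \<alpha>\<close> is the conjugate of \<open>p + q * \<alpha>\<close>. Their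
  product is the rational norm \<open>N\<close>, and the inverse is the conjugate divided by
  \<open>N\<close>.\<close>

lemma quadratic_span_inverse:
  fixes \<alpha> :: real
  assumes irr: "\<alpha> \<notin> \<rat>" and root: "\<alpha>\<^sup>2 + of_int n * \<alpha> + of_int c = 0"
    and pq: "p \<in> \<rat>" "q \<in> \<rat>" and nz: "p + q * \<alpha> \<noteq> 0"
  shows "\<exists>p'\<in>\<rat>. \<exists>q'\<in>\<rat>. inverse (p + q * \<alpha>) = p' + q' * \<alpha>"
proof -
  define N where "N = p\<^sup>2 - of_int n * p * q + of_int c * q\<^sup>2"
  have "(p + q * \<alpha>) * (p - of_int n * q - q * \<alpha>) =
      N - q\<^sup>2 * (\<alpha>\<^sup>2 + of_int n * \<alpha> + of_int c)"
    unfolding N_def by (simp add: power2_eq_square algebra_simps)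
  then have N: "(p + q * \<alpha>) * (p - of_int n * q - q * \<alpha>) = N"
    using root by simp
  \<comment> \<open>If the norm vanished, so would the conjugate; irrationality of \<alpha> then
    gives \<open>q = 0\<close>, hence \<open>p = 0\<close>.\<close>
  have "N \<noteq> 0"
  proof
    assume "N = 0"
    then have conj0: "p - of_int n * q - q * \<alpha> = 0"
      using N nz by auto
    have "q = 0"
    proof (rule ccontr)
      assume "q \<noteq> 0"
      then have "\<alpha> = (p - of_int n * q) / q"
        using conj0 by (simp add: field_simps)
      also have "\<dots> \<in> \<rat>" using pq by auto
      finally show False using irr by simp
    qed
    then show False using conj0 nz by simp
  qed
  then have "inverse (p + q * \<alpha>) = (p - of_int n * q) / N + (- q / N) * \<alpha>"
    using N nz by (simp add: divide_simps) (simp add: algebra_simps)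
  moreover have "N \<in> \<rat>" using pq by (simp add: N_def)
  ultimately show ?thesis using pq by (metis Rats_diff Rats_divide Rats_minus_iff Rats_mult Rats_of_int)
qed

text \<open>The rational span of 1 and \<alpha> is closed under the field operations: products are
  reduced by the quadratic equation, inverses come from the norm.\<close>

lemma rat_adjoin_quadratic:
  fixes \<alpha> :: real
  assumes irr: "\<alpha> \<notin> \<rat>" and root: "\<alpha>\<^sup>2 + of_int n * \<alpha> + of_int c = 0"
    and z: "z \<in> rat_adjoin (of_real \<alpha>)"
  shows "\<exists>p\<in>\<rat>. \<exists>q\<in>\<rat>. z = of_real (p + q * \<alpha>)"
  using z unfolding rat_adjoin_def
proof (induction rule: generate_field.induct)
  case one
  show ?case
    by (rule bexI[of _ 1], rule bexI[of _ 0]) (auto simp: ring_of_type_algebra_def)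
next
  case (incl h)
  then show ?case
    by (intro bexI[of _ 0] bexI[of _ 1]) auto
next
  case (a_inv h)
  then obtain p q where "p \<in> \<rat>" "q \<in> \<rat>" "h = of_real (p + q * \<alpha>)" by blast
  moreover have "\<ominus>\<^bsub>ring_of_type_algebra\<^esub> h = - h"
    by (rule a_inv_ring_of_type_algebra)
  ultimately show ?case
    by (intro bexI[of _ "- p"] bexI[of _ "- q"]) auto
next
  case (m_inv h)
  then obtain p q where pq: "p \<in> \<rat>" "q \<in> \<rat>" and h: "h = of_real (p + q * \<alpha>)" by blast
  have "h \<noteq> 0" using m_inv by (simp add: ring_of_type_algebra_def)
  moreover have "p + q * \<alpha> \<noteq> 0" using h \<open>h \<noteq> 0\<close> by (metis of_real_0)
  ultimately show ?case
    using quadratic_span_inverse[OF irr root pq]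
    by (metis h m_inv_ring_of_type_algebra of_real_inverse)
next
  case (eng_add h1 h2)
  then obtain p q p' q' where "p \<in> \<rat>" "q \<in> \<rat>" "h1 = of_real (p + q * \<alpha>)"
    "p' \<in> \<rat>" "q' \<in> \<rat>" "h2 = of_real (p' + q' * \<alpha>)" by blast
  then show ?case
    by (intro bexI[of _ "p + p'"] bexI[of _ "q + q'"])
       (auto simp: ring_of_type_algebra_def algebra_simps)
next
  case (eng_mult h1 h2)
  then obtain p q p' q' where pq: "p \<in> \<rat>" "q \<in> \<rat>" "h1 = of_real (p + q * \<alpha>)"
    "p' \<in> \<rat>" "q' \<in> \<rat>" "h2 = of_real (p' + q' * \<alpha>)" by blast
  have "(p + q * \<alpha>) * (p' + q' * \<alpha>) =
      (p * p' - of_int c * q * q') + (p * q' + q * p' - of_int n * q * q') * \<alpha> +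
      q * q' * (\<alpha>\<^sup>2 + of_int n * \<alpha> + of_int c)"
    by (simp add: power2_eq_square algebra_simps)
  then have "(p + q * \<alpha>) * (p' + q' * \<alpha>) =
      (p * p' - of_int c * q * q') + (p * q' + q * p' - of_int n * q * q') * \<alpha>"
    using root by simp
  then have "h1 \<otimes>\<^bsub>ring_of_type_algebra\<^esub> h2 =
      of_real ((p * p' - of_int c * q * q') + (p * q' + q * p' - of_int n * q * q') * \<alpha>)"
    unfolding pq by (simp add: ring_of_type_algebra_def del: of_real_add of_real_diff flip: of_real_mult)
  then show ?case using pq by (metis Rats_add Rats_diff Rats_mult Rats_of_int)
qed

lemma rat_adjoin_quadratic_neq:
  fixes \<alpha> \<beta> :: real and n c d :: int
  assumes \<alpha>: "0 < \<alpha>" "\<alpha> < 1" "\<alpha>\<^sup>2 + of_int n * \<alpha> + of_int c = 0"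
    and \<beta>: "0 < \<beta>" "\<beta> < 1" "\<beta>\<^sup>2 + of_int n * \<beta> + of_int d = 0"
    and "\<alpha> \<noteq> \<beta>"
  shows "rat_adjoin (of_real \<alpha>) \<noteq> rat_adjoin (of_real \<beta>)"
proof
  assume eq: "rat_adjoin (of_real \<alpha>) = rat_adjoin (of_real \<beta>)"
  have irrational: "x \<notin> \<rat>"
    if "0 < x" "x < 1" "x\<^sup>2 + of_int n * x + of_int e = 0" for x :: real and e
    using Rats_int_root_imp_Ints[of x n e] that by (auto elim!: Ints_cases)
  have irr: "\<alpha> \<notin> \<rat>" "\<beta> \<notin> \<rat>" using irrational \<alpha> \<beta> by blast+
  have "of_real \<beta> \<in> rat_adjoin (of_real \<alpha>)"
    unfolding eq by (simp add: rat_adjoin_def generate_field.incl)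
  then obtain p q where pq: "p \<in> \<rat>" "q \<in> \<rat>" and \<beta>_eq: "\<beta> = p + q * \<alpha>"
    using rat_adjoin_quadratic[OF irr(1) \<alpha>(3)] by (metis of_real_eq_iff)
  define D where "D = n\<^sup>2 - 4 * c"
  define E where "E = n\<^sup>2 - 4 * d"
  have D: "of_int D = (2 * \<alpha> + of_int n)\<^sup>2" and E: "of_int E = (2 * \<beta> + of_int n)\<^sup>2"
    using \<alpha>(3) \<beta>(3) unfolding D_def E_def by (simp_all add: power2_eq_square algebra_simps)
  have "q \<noteq> 0" using \<beta>_eq irr pq by auto
  \<comment> \<open>Substituting \<open>\<beta> = p + q * \<alpha>\<close> into the equation of
    \<beta> and subtracting \<open>q\<^sup>2\<close> times that of \<alpha> leaves the linear
    relation \<open>u * \<alpha> = v\<close> over the rationals; as \<alpha> is irrational,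
    \<open>u\<close> must vanish.\<close>
  define u where "u = q * (2 * p + of_int n - of_int n * q)"
  define v where "v = of_int c * q\<^sup>2 - p\<^sup>2 - of_int n * p - of_int d"
  have "u * \<alpha> - v = (\<beta>\<^sup>2 + of_int n * \<beta> + of_int d) - q\<^sup>2 * (\<alpha>\<^sup>2 + of_int n * \<alpha> + of_int c)"
    unfolding u_def v_def \<beta>_eq by (simp add: power2_eq_square algebra_simps)
  then have uv: "u * \<alpha> = v"
    using \<alpha>(3) \<beta>(3) by simp
  have "u = 0"
  proof (rule ccontr)
    assume "u \<noteq> 0"
    then have "\<alpha> = v / u" using uv by (simp add: field_simps)
    also have "\<dots> \<in> \<rat>" using pq by (auto simp: u_def v_def)
    finally show False using irr by simp
  qed
  then have "2 * p + of_int n = of_int n * q" using \<open>q \<noteq> 0\<close> by (simp add: u_def)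
  \<comment> \<open>The square roots of the two discriminants are thus rational multiples of each
    other, and \<open>q * D\<close> is their product.\<close>
  then have conj: "2 * \<beta> + of_int n = q * (2 * \<alpha> + of_int n)"
    unfolding \<beta>_eq by (simp add: algebra_simps)
  have sq: "(q * of_int D)\<^sup>2 = of_int (D * E)"
    using conj D E by (simp add: power2_eq_square)
  have "q * of_int D \<in> \<int>"
    \<comment> \<open>The rational number \<open>q * D\<close> is a root of
      \<open>x\<^sup>2 - D * E\<close>.\<close>
    by (rule Rats_int_root_imp_Ints[of _ 0 "- (D * E)"]) (use sq pq in auto)
  then obtain r :: int where r: "q * of_int D = of_int r" by (auto elim: Ints_cases)
  have "real_of_int (r\<^sup>2) = of_int (D * E)"
    using sq r by simp
  then have "r\<^sup>2 = D * E" by linarith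
  \<comment> \<open>Both discriminants are congruent to \<open>n\<^sup>2\<close> modulo 4, so
    \<open>r\<close> has the parity of \<open>n\<close>. This supplies the second factor 2 in
    \<open>D + E - 2 * r\<close>.\<close>
  then have "even (r\<^sup>2) \<longleftrightarrow> even n"
    by (simp add: D_def E_def)
  then have "even (n\<^sup>2 - r)" by simp
  then obtain s where s: "n\<^sup>2 - r = 2 * s" by (rule evenE)
  have "(2 * \<alpha> + of_int n) * (2 * \<beta> + of_int n) = of_int r"
    unfolding conj r[symmetric] D by (simp add: power2_eq_square)
  \<comment> \<open>Expand the square of
    \<open>(2 * \<alpha> + n) - (2 * \<beta> + n)\<close>.\<close>
  then have "4 * (\<alpha> - \<beta>)\<^sup>2 = of_int (D + E - 2 * r)"
    by (simp add: D E) (simp add: power2_eq_square algebra_simps)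
  also have "D + E - 2 * r = 4 * (s - c - d)"
    using s unfolding D_def E_def by simp
  finally have int: "(\<alpha> - \<beta>)\<^sup>2 = of_int (s - c - d)" by simp
  have "\<bar>\<alpha> - \<beta>\<bar> < 1" using \<alpha> \<beta> by auto
  then have "(\<alpha> - \<beta>)\<^sup>2 < 1" by (simp add: abs_square_less_1)
  moreover have "(\<alpha> - \<beta>)\<^sup>2 > 0" using \<open>\<alpha> \<noteq> \<beta>\<close> by simp
  ultimately show False unfolding int of_int_0_less_iff of_int_less_1_iff by linarith
qed

theorem theorem2:
  fixes b :: int
  assumes "b \<noteq> 0" and "b \<noteq> - 1" and "b \<noteq> - 2"
  shows "\<forall>\<alpha>\<in>I2r b. \<forall>\<beta>\<in>I2r b. \<alpha> \<noteq> \<beta> \<longrightarrow>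
           rat_adjoin (complex_of_real \<alpha>) \<noteq> rat_adjoin (complex_of_real \<beta>)"
proof -
  \<comment> \<open>The three excluded values are exactly those at which \<open>I2r\<close> is
    \<open>undefined\<close>.\<close>
  have "b \<ge> 1 \<or> b \<le> - 3" using assms by linarith
  then have root: "\<exists>c::int. 0 < x \<and> x < 1 \<and> x\<^sup>2 + of_int b * x + of_int c = 0"
    if "x \<in> I2r b" for x
    using that by (auto simp: I2r_def split: if_splits)
  show ?thesis
    using root rat_adjoin_quadratic_neq by meson
qed

end
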